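(* There is a universal constant $c$ such that the following holds. Consider the source model in which all source symbols have length $L$, in the asymptotic regime described in the context. For fixed-length deduplication (FLD) with chunk length $L$ and any edit probability $\delta\in(0,\frac12)$, the compression ratio satisfies $\frac{\mathbb{E}[|\boldsymbol{s}|]}{\mathbb{E}[\mathcal{L}_{F}(\boldsymbol{s})]}\le c$ for all sufficiently large $B$.
   Context: All logarithms are base 2. Source model (equal symbol lengths). Parameters: positive integers $A,B,L$ and an edit probability $\delta$. Source symbols $X_1,\dots,X_A$ are drawn independently and uniformly from $\{0,1\}^L$ (with replacement). Then, independently for $b=1,\dots,B$, an index $J_b$ is drawn uniformly from $\{1,\dots,A\}$ and the source block $Y_b$ is obtained from $X_{J_b}$ by a $\delta$-edit, i.e. by flipping each bit independently with probability $\delta$. The data stream is $\boldsymbol{s}=Y_1Y_2\cdots Y_B$. Asymptotic regime. $B\to\infty$; $A$ and $L$ are functions of $B$ tending to infinity with $A\le B^{1-k_2}$ for a fixed $0<k_2<1$ and $L=\Theta(B^{k_1})$ for a fixed $k_1>0$; $\delta\in(0,\frac12)$ is constant. Fixed-length deduplication (FLD) with chunk length $\ell$: $\boldsymbol{s}$ is parsed into consecutive chunks of length $\ell$ (the last possibly shorter). The encoding starts with a prefix-free (Elias gamma) encoding of $|\boldsymbol{s}|$. Chunks are then processed in order, starting with an empty dictionary. A chunk different from all previous chunks is encoded as the bit 1 followed by the chunk itself, and is entered into the dictionary. A chunk equal to an earlier one is encoded as the bit 0 followed by a pointer (index) to its dictionary entry; if the current dictionary has size $t$, the pointer takes $\lceil\log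 t\rceil$ bits. $\mathcal{L}_{F}(\boldsymbol{s})$ is the number of bits used to encode $\boldsymbol{s}$. *)

theory Defs
  imports "HOL-Probability.Probability" "HOL-Library.Landau_Symbols"
begin

section \<open>Source model\<close>

text \<open>Bit strings are boolean lists.\<close>

definition uniform_bits :: "nat \<Rightarrow> bool list pmf" where
  "uniform_bits L = pmf_of_set {x. length x = L}"

definition edit_pmf :: "real \<Rightarrow> bool list \<Rightarrow> bool list pmf" where
  "edit_pmf \<delta> x =
     map_pmf (\<lambda>flips. map2 (\<noteq>) x flips) (replicate_pmf (length x) (bernoulli_pmf \<delta>))"

definition symbols_pmf :: "nat \<Rightarrow> nat \<Rightarrow> (nat \<Rightarrow> bool list) pmf" where
  "symbols_pmf A L = Pi_pmf {1..A} [] (\<lambda>_. uniform_bits L)"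

definition block_pmf :: "nat \<Rightarrow> real \<Rightarrow> (nat \<Rightarrow> bool list) \<Rightarrow> bool list pmf" where
  "block_pmf A \<delta> X = do { j \<leftarrow> pmf_of_set {1..A}; edit_pmf \<delta> (X j) }"

text \<open>The symbols are drawn once and shared by all blocks; given the symbols, the \<open>B\<close> blocks
  are independent and identically distributed.\<close>

definition source_pmf :: "nat \<Rightarrow> nat \<Rightarrow> nat \<Rightarrow> real \<Rightarrow> bool list pmf" where
  "source_pmf A B L \<delta> = do {
     X \<leftarrow> symbols_pmf A L;
     Ys \<leftarrow> replicate_pmf B (block_pmf A \<delta> X);
     return_pmf (concat Ys)
   }"

section \<open>Fixed-length deduplication\<close>

text \<open>Big-endian binary representation of \<open>n mod 2 ^ w\<close> with exactly \<open>w\<close> bits.\<close>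

definition binary :: "nat \<Rightarrow> nat \<Rightarrow> bool list" where
  "binary w n = map (\<lambda>i. bit n i) (rev [0..<w])"

text \<open>Meaningful for positive \<open>n\<close> only.\<close>

definition elias_gamma :: "nat \<Rightarrow> bool list" where
  "elias_gamma n =
     (let k = nat \<lfloor>log 2 (real n)\<rfloor> in replicate k False @ binary (k + 1) n)"

text \<open>The guard on \<open>l = 0\<close> only serves termination; chunk lengths are positive.\<close>

function chunks :: "nat \<Rightarrow> 'a list \<Rightarrow> 'a list list" where
  "chunks l s = (if l = 0 \<or> s = [] then [] else take l s # chunks l (drop l s))"
  by pat_completeness auto
termination
  by (relation "Wellfounded.measure (\<lambda>(l, s). length s)") auto

declare chunks.simps [simp del]

text \<open>The dictionary \<open>D\<close> lists the distinct chunks in order of first occurrence. The pointer to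
  \<open>c\<close> is its zero-based position in \<open>D\<close>, which is less than \<open>length D\<close> and hence fits into
  \<open>\<lceil>log 2 (length D)\<rceil>\<close> bits.\<close>

fun fld_chunks :: "bool list list \<Rightarrow> bool list list \<Rightarrow> bool list" where
  "fld_chunks D [] = []"
| "fld_chunks D (c # cs) =
     (if c \<in> set D
      then False # binary (nat \<lceil>log 2 (real (length D))\<rceil>) (length (takeWhile (\<lambda>d. d \<noteq> c) D))
             @ fld_chunks D cs
      else True # c @ fld_chunks (D @ [c]) cs)"

definition fld_encode :: "nat \<Rightarrow> bool list \<Rightarrow> bool list" where
  "fld_encode l s = elias_gamma (length s) @ fld_chunks [] (chunks l s)"

definition fld_length :: "nat \<Rightarrow> bool list \<Rightarrow> nat" where
  "fld_length l s = length (fld_encode l s)"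

definition fld_ratio :: "nat \<Rightarrow> nat \<Rightarrow> nat \<Rightarrow> real \<Rightarrow> nat \<Rightarrow> real" where
  "fld_ratio A B L \<delta> l =
     measure_pmf.expectation (source_pmf A B L \<delta>) (\<lambda>s. real (length s)) /
     measure_pmf.expectation (source_pmf A B L \<delta>) (\<lambda>s. real (fld_length l s))"

section \<open>Asymptotic regime\<close>

text \<open>\<open>A\<close> and \<open>L\<close> are functions of \<open>B\<close>. Only their values for large \<open>B\<close> matter, so the bound on
  \<open>A\<close> is required eventually; positivity of \<open>A B\<close> and \<open>L B\<close> for large \<open>B\<close> follows from
  divergence.\<close>

definition asymptotic_regime ::
  "real \<Rightarrow> real \<Rightarrow> (nat \<Rightarrow> nat) \<Rightarrow> (nat \<Rightarrow> nat) \<Rightarrow> bool" where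
  "asymptotic_regime k1 k2 A L \<longleftrightarrow>
     0 < k1 \<and> 0 < k2 \<and> k2 < 1 \<and>
     filterlim A at_top sequentially \<and>
     filterlim L at_top sequentially \<and>
     (\<forall>\<^sub>F B in sequentially. real (A B) \<le> real B powr (1 - k2)) \<and>
     (\<lambda>B. real (L B)) \<in> \<Theta>(\<lambda>B. real B powr k1)"

end

theory Submission
  imports Defs "HOL-Real_Asymp.Real_Asymp"
begin

text \<open>Given the symbols, every block takes any fixed value with probability at most
  \<open>(1 - \<delta>) ^ L\<close>. By a union bound over pairs, all \<open>B\<close> blocks are distinct with probability at
  least \<open>1 - B\<^sup>2 (1 - \<delta>) ^ L\<close>, which tends to \<open>1\<close> since \<open>L\<close> grows polynomially in \<open>B\<close>. When the
  blocks are distinct, no chunk is deduplicated and the encoding has at least \<open>B L\<close> bits. Hence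
  every constant above \<open>1\<close> works; we use \<open>2\<close>.\<close>

section \<open>Probability mass functions\<close>

lemma pmf_bind_le:
  assumes "\<And>x. x \<in> set_pmf M \<Longrightarrow> pmf (f x) y \<le> q"
  shows "pmf (bind_pmf M f) y \<le> q"
proof -
  have "pmf (bind_pmf M f) y = measure_pmf.expectation M (\<lambda>x. pmf (f x) y)"
    by (rule pmf_bind)
  also have "\<dots> \<le> q"
    by (intro measure_pmf.integral_le_const measure_pmf.integrable_const_bound[where B = 1])
       (auto simp: AE_measure_pmf_iff pmf_le_1 assms)
  finally show ?thesis .
qed

lemma measure_bind_pmf:
  "measure_pmf.prob (bind_pmf M f) S = measure_pmf.expectation M (\<lambda>x. measure_pmf.prob (f x) S)"
proof -
  have "ennreal (measure_pmf.prob (bind_pmf M f) S) =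
      (\<integral>\<^sup>+x. ennreal (measure_pmf.prob (f x) S) \<partial>measure_pmf M)"
    unfolding measure_pmf.emeasure_eq_measure[symmetric] by (rule emeasure_bind_pmf)
  also have "\<dots> = ennreal (measure_pmf.expectation M (\<lambda>x. measure_pmf.prob (f x) S))"
    by (intro nn_integral_eq_integral measure_pmf.integrable_const_bound[where B = 1]) auto
  finally show ?thesis by (simp add: integral_nonneg_AE)
qed

lemma measure_bind_pmf_le:
  assumes "\<And>x. x \<in> set_pmf M \<Longrightarrow> measure_pmf.prob (f x) S \<le> q"
  shows "measure_pmf.prob (bind_pmf M f) S \<le> q"
  unfolding measure_bind_pmf
  by (intro measure_pmf.integral_le_const measure_pmf.integrable_const_bound[where B = 1])
     (auto simp: AE_measure_pmf_iff assms)

text \<open>Entries are independent, so a list of length \<open>n\<close> has the product of its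
  entries' probabilities; any other list has probability 0. Applied to flip patterns.\<close>

lemma pmf_replicate_pmf_le:
  assumes "\<And>x. pmf p x \<le> q"
  shows "pmf (replicate_pmf n p) xs \<le> q ^ n"
proof (induction n arbitrary: xs)
  case 0
  then show ?case by (simp add: pmf_le_1)
next
  case (Suc n)
  have q: "0 \<le> q" using order_trans[OF pmf_nonneg assms] .
  have eq: "replicate_pmf (Suc n) p = map_pmf (\<lambda>(x, xs). x # xs) (pair_pmf p (replicate_pmf n p))"
    by (simp add: pair_pmf_def map_bind_pmf)
  show ?case
  proof (cases xs)
    case Nil
    then show ?thesis using q by (auto simp: pmf_eq_0_set_pmf[THEN iffD2] eq)
  next
    case (Cons y ys)
    have "pmf (replicate_pmf (Suc n) p) xs = pmf p y * pmf (replicate_pmf n p) ys"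
      unfolding eq Cons
      by (subst pmf_map_inj'[of "\<lambda>(x, xs). x # xs" _ "(y, ys)", simplified])
         (auto simp: inj_def pmf_pair)
    also have "\<dots> \<le> q * q ^ n"
      by (intro mult_mono assms Suc.IH) (auto simp: q)
    finally show ?thesis by simp
  qed
qed

lemma measure_pmf_set_le:
  assumes "\<And>x. pmf p x \<le> q"
  shows "measure_pmf.prob p (set xs) \<le> real (length xs) * q"
proof (induction xs)
  case (Cons x xs)
  have "measure_pmf.prob p (set (x # xs)) \<le> measure_pmf.prob p {x} + measure_pmf.prob p (set xs)"
    using measure_Un_le[of "{x}" "measure_pmf p" "set xs"] by simp
  also have "\<dots> \<le> q + real (length xs) * q"
    using Cons assms[of x] by (simp add: measure_pmf_single)
  finally show ?case by (simp add: algebra_simps)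
qed simp

text \<open>Birthday bound by induction: a new entry hits one of the \<open>n\<close> others with
  probability at most \<open>n * q\<close>, and \<open>n + n^2\<close> is at most
  \<open>(n + 1)^2\<close>.\<close>

lemma measure_replicate_pmf_not_distinct_le:
  assumes "\<And>x. pmf p x \<le> q"
  shows "measure_pmf.prob (replicate_pmf n p) {xs. \<not> distinct xs} \<le> real n ^ 2 * q"
proof (induction n)
  case 0
  then show ?case by simp
next
  case (Suc n)
  have q: "0 \<le> q" using order_trans[OF pmf_nonneg assms] .
  let ?R = "replicate_pmf n p"
  let ?P = "pair_pmf ?R p"
  \<comment> \<open>The two draws are commuted so that the tail comes first; given the tail, the
    head is a fresh sample from \<open>p\<close>.\<close>
  have "replicate_pmf (Suc n) p = map_pmf (\<lambda>(xs, x). x # xs) ?P"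
    by (simp add: pair_pmf_def map_bind_pmf) (rule bind_commute_pmf)
  hence "measure_pmf.prob (replicate_pmf (Suc n) p) {xs. \<not> distinct xs} =
      measure_pmf.prob ?P ({(xs, x). x \<in> set xs} \<union> fst -` {xs. \<not> distinct xs})"
    by (auto intro!: arg_cong[where f = "measure _"])
  also have "\<dots> \<le> measure_pmf.prob ?P {(xs, x). x \<in> set xs}
      + measure_pmf.prob ?P (fst -` {xs. \<not> distinct xs})"
    by (rule measure_Un_le) auto
  also have "measure_pmf.prob ?P (fst -` {xs. \<not> distinct xs}) =
      measure_pmf.prob ?R {xs. \<not> distinct xs}"
    by (subst measure_map_pmf[symmetric]) (simp add: map_fst_pair_pmf)
  also have "measure_pmf.prob ?P {(xs, x). x \<in> set xs} \<le> real n * q"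
  proof -
    have "?P = bind_pmf ?R (\<lambda>xs. map_pmf (Pair xs) p)"
      by (simp add: pair_pmf_def map_pmf_def)
    moreover have "measure_pmf.prob (map_pmf (Pair xs) p) {(xs, x). x \<in> set xs} \<le> real n * q"
      if "xs \<in> set_pmf ?R" for xs
      using that measure_pmf_set_le[OF assms, of xs]
      by (auto simp: set_replicate_pmf vimage_def)
    ultimately show ?thesis by (metis measure_bind_pmf_le)
  qed
  also have "real n * q + measure_pmf.prob ?R {xs. \<not> distinct xs} \<le> real n * q + real n ^ 2 * q"
    using Suc.IH by simp
  also have "\<dots> \<le> real (Suc n) ^ 2 * q"
    using q by (auto simp: power2_eq_square algebra_simps)
  finally show ?case by simp
qed

section \<open>The source\<close>

lemma length_edit_pmf: "y \<in> set_pmf (edit_pmf \<delta> x) \<Longrightarrow> length y = length x"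
  by (auto simp: edit_pmf_def set_replicate_pmf)

text \<open>Only one flip pattern turns \<open>x\<close> into \<open>y\<close>, and each of its bits
  has probability \<delta> or \<open>1 - \<delta>\<close>, of which the latter is larger.\<close>

lemma pmf_edit_pmf_le:
  assumes "0 < \<delta>" "\<delta> < 1 / 2"
  shows "pmf (edit_pmf \<delta> x) y \<le> (1 - \<delta>) ^ length x"
proof -
  let ?R = "replicate_pmf (length x) (bernoulli_pmf \<delta>)"
  let ?f = "map2 (\<noteq>) x"
  \<comment> \<open>Xor with \<open>x\<close> is an involution on lists of the same length. The
    restriction to the support matters because \<open>map2\<close> truncates longer lists.\<close>
  have "?f -` {y} \<inter> set_pmf ?R \<subseteq> {map2 (\<noteq>) x y}"
    by (auto simp: set_replicate_pmf intro!: nth_equalityI)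
  hence "measure_pmf.prob ?R (?f -` {y}) \<le> measure_pmf.prob ?R {map2 (\<noteq>) x y}"
    by (intro measure_pmf.finite_measure_mono_AE) (auto simp: AE_measure_pmf_iff)
  also have "\<dots> \<le> (1 - \<delta>) ^ length x"
    unfolding measure_pmf_single
  proof (rule pmf_replicate_pmf_le)
    show "pmf (bernoulli_pmf \<delta>) b \<le> 1 - \<delta>" for b
      using assms by (cases b) auto
  qed
  finally show ?thesis by (simp add: edit_pmf_def pmf_map)
qed

lemma length_symbols_pmf:
  assumes "X \<in> set_pmf (symbols_pmf A L)" "j \<in> {1..A}"
  shows "length (X j) = L"
proof -
  have "finite {x :: bool list. length x = L}"
    using finite_lists_length_eq[of "UNIV :: bool set" L] by simp
  moreover have "{x :: bool list. length x = L} \<noteq> {}"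
    using length_replicate[of L False] by blast
  ultimately have "set_pmf (uniform_bits L) = {x. length x = L}"
    unfolding uniform_bits_def by (intro set_pmf_of_set)
  thus ?thesis
    using assms by (auto simp: symbols_pmf_def set_Pi_pmf PiE_dflt_def)
qed

lemma length_block_pmf:
  assumes "0 < A" "X \<in> set_pmf (symbols_pmf A L)" "y \<in> set_pmf (block_pmf A \<delta> X)"
  shows "length y = L"
  using assms length_symbols_pmf[OF assms(2)] length_edit_pmf
  by (fastforce simp: block_pmf_def)

text \<open>The bound holds for each index \<open>j\<close>, hence for the mixture. It is uniform in
  \<open>X\<close>, so it survives conditioning on the symbols.\<close>

lemma pmf_block_pmf_le:
  assumes "0 < A" "X \<in> set_pmf (symbols_pmf A L)" "0 < \<delta>" "\<delta> < 1 / 2"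
  shows "pmf (block_pmf A \<delta> X) y \<le> (1 - \<delta>) ^ L"
  unfolding block_pmf_def
proof (rule pmf_bind_le)
  fix j assume "j \<in> set_pmf (pmf_of_set {1..A})"
  hence "length (X j) = L"
    using assms length_symbols_pmf by simp
  thus "pmf (edit_pmf \<delta> (X j)) y \<le> (1 - \<delta>) ^ L"
    using pmf_edit_pmf_le[OF assms(3,4)] by metis
qed

lemma length_concat_same:
  "\<forall>y\<in>set ys. length y = l \<Longrightarrow> length (concat ys) = length ys * l"
  by (induction ys) auto

lemma length_source_pmf:
  assumes "0 < A" "s \<in> set_pmf (source_pmf A B L \<delta>)"
  shows "length s = B * L"
proof -
  obtain X Ys where "X \<in> set_pmf (symbols_pmf A L)"
    "Ys \<in> set_pmf (replicate_pmf B (block_pmf A \<delta> X))" "s = concat Ys"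
    using assms by (auto simp: source_pmf_def)
  thus ?thesis
    using length_block_pmf[OF assms(1), of X L _ \<delta>] length_concat_same[of Ys L]
    by (simp add: set_replicate_pmf in_lists_conv_set)
qed

section \<open>Fixed-length deduplication of distinct blocks\<close>

text \<open>Edits by flips preserve length, so chunk boundaries coincide with block boundaries and
  the chunks are exactly the blocks.\<close>

lemma chunks_concat:
  assumes "0 < l" "\<forall>y\<in>set ys. length y = l"
  shows "chunks l (concat ys) = ys"
  using assms(2)
proof (induction ys)
  case Nil
  then show ?case by (simp add: chunks.simps)
next
  case (Cons y ys)
  then show ?case using assms(1) by (subst chunks.simps) auto
qed

text \<open>Stated for arbitrary \<open>D\<close> because the dictionary grows along the recursion;
  distinctness keeps the remaining chunks disjoint from it. Every chunk then costs its flag bit plus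
  \<open>l\<close> bits.\<close>

lemma length_fld_chunks_distinct:
  assumes "distinct cs" "set cs \<inter> set D = {}" "\<forall>c\<in>set cs. length c = l"
  shows "length (fld_chunks D cs) = length cs * (l + 1)"
  using assms by (induction D cs rule: fld_chunks.induct) auto

lemma fld_length_concat_ge:
  assumes "0 < l" "\<forall>y\<in>set ys. length y = l" "distinct ys"
  shows "length ys * l \<le> fld_length l (concat ys)"
  using assms chunks_concat[of l ys] length_fld_chunks_distinct[of ys "[]" l]
  by (simp add: fld_length_def fld_encode_def)

text \<open>Given the symbols, a short encoding forces two equal blocks almost surely; averaging
  over the symbols keeps the bound.\<close>

lemma prob_fld_length_less:
  assumes "0 < A" "0 < L" "0 < \<delta>" "\<delta> < 1 / 2"
  shows "measure_pmf.prob (source_pmf A B L \<delta>) {s. fld_length L s < B * L}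
    \<le> real B ^ 2 * (1 - \<delta>) ^ L"
  unfolding source_pmf_def
proof (rule measure_bind_pmf_le)
  fix X assume X: "X \<in> set_pmf (symbols_pmf A L)"
  let ?R = "replicate_pmf B (block_pmf A \<delta> X)"
  have "distinct Ys \<Longrightarrow> B * L \<le> fld_length L (concat Ys)" if "Ys \<in> set_pmf ?R" for Ys
    using that length_block_pmf[OF assms(1) X, of _ \<delta>] fld_length_concat_ge[OF assms(2), of Ys]
    by (simp add: set_replicate_pmf in_lists_conv_set)
  hence "measure_pmf.prob ?R (concat -` {s. fld_length L s < B * L})
      \<le> measure_pmf.prob ?R {Ys. \<not> distinct Ys}"
    by (intro measure_pmf.finite_measure_mono_AE) (fastforce simp: AE_measure_pmf_iff)+
  also have "\<dots> \<le> real B ^ 2 * (1 - \<delta>) ^ L"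
    by (intro measure_replicate_pmf_not_distinct_le pmf_block_pmf_le assms X)
  finally show "measure_pmf.prob (bind_pmf ?R (\<lambda>Ys. return_pmf (concat Ys)))
      {s. fld_length L s < B * L} \<le> real B ^ 2 * (1 - \<delta>) ^ L"
    by (simp add: map_pmf_def[symmetric])
qed

text \<open>The numerator is exactly \<open>B * L\<close>, and the denominator is at least
  \<open>B * L\<close> times the probability, at least 1/2, that the encoding is not short.\<close>

lemma fld_ratio_le_2:
  assumes "0 < A" "0 < B" "0 < L" "0 < \<delta>" "\<delta> < 1 / 2" "real B ^ 2 * (1 - \<delta>) ^ L \<le> 1 / 2"
  shows "fld_ratio A B L \<delta> L \<le> 2"
proof -
  let ?S = "source_pmf A B L \<delta>"
  let ?bad = "{s. fld_length L s < B * L}"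
  have "finite {s :: bool list. length s = B * L}"
    using finite_lists_length_eq[of "UNIV :: bool set" "B * L"] by simp
  \<comment> \<open>Finite support supplies the integrability needed for monotonicity of the
    expectation.\<close>
  hence fin: "finite (set_pmf ?S)"
    by (rule rev_finite_subset) (auto dest: length_source_pmf[OF assms(1)])
  have "measure_pmf.expectation ?S (\<lambda>s. real (length s)) =
      measure_pmf.expectation ?S (\<lambda>_. real (B * L))"
    by (intro integral_cong_AE) (auto simp: AE_measure_pmf_iff dest: length_source_pmf[OF assms(1)])
  hence len: "measure_pmf.expectation ?S (\<lambda>s. real (length s)) = real (B * L)"
    by simp
  have "measure_pmf.prob ?S ?bad \<le> 1 / 2"
    using prob_fld_length_less[OF assms(1,3-5), of B] assms(6) by linarith
  hence "1 / 2 \<le> measure_pmf.prob ?S (- ?bad)"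
    using measure_pmf.prob_compl[of ?bad ?S] by (simp add: Compl_eq_Diff_UNIV)
  hence "real (B * L) * (1 / 2) \<le> real (B * L) * measure_pmf.prob ?S (- ?bad)"
    by (intro mult_left_mono) auto
  also have "\<dots> = measure_pmf.expectation ?S (\<lambda>s. real (B * L) * indicator (- ?bad) s)"
    by simp
  also have "\<dots> \<le> measure_pmf.expectation ?S (\<lambda>s. real (fld_length L s))"
    by (intro integral_mono integrable_measure_pmf_finite[OF fin])
       (auto simp: indicator_def not_less simp flip: of_nat_mult)
  finally have "real (B * L) / 2 \<le> measure_pmf.expectation ?S (\<lambda>s. real (fld_length L s))"
    by simp
  moreover have "0 < real (B * L)" using assms by simp
  ultimately show ?thesis
    unfolding fld_ratio_def len by (subst pos_divide_le_eq) linarith+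
qed

text \<open>A polynomial lower bound on \<open>L\<close> makes the power decay like a stretched
  exponential in \<open>B\<close>, which beats the quadratic factor.\<close>

lemma eventually_power2_mult_power_le:
  fixes k \<delta> :: real and L :: "nat \<Rightarrow> nat"
  assumes "0 < k" "0 < \<delta>" "\<delta> < 1" "(\<lambda>B. real (L B)) \<in> \<Omega>(\<lambda>B. real B powr k)" "0 < \<epsilon>"
  shows "\<forall>\<^sub>F B in sequentially. real B ^ 2 * (1 - \<delta>) ^ L B \<le> \<epsilon>"
proof -
  obtain c where c: "0 < c" "\<forall>\<^sub>F B in sequentially. c * real B powr k \<le> real (L B)"
    using assms(4) by (auto elim!: landau_omega.bigE)
  \<comment> \<open>Chosen so that \<open>1 - \<delta>\<close> raised to \<open>c * B powr k\<close>
    equals \<open>exp (- a * B powr k)\<close>; positive since the logarithm is negative.\<close>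
  define a where "a = - c * ln (1 - \<delta>)"
  have "0 < a" using assms c by (simp add: a_def mult_pos_neg)
  hence "((\<lambda>B. real B ^ 2 * exp (- a * real B powr k)) \<longlongrightarrow> 0) sequentially"
    using assms(1) by real_asymp
  hence "\<forall>\<^sub>F B in sequentially. real B ^ 2 * exp (- a * real B powr k) < \<epsilon>"
    using assms(5) by (rule order_tendstoD)
  with c(2) show ?thesis
  proof eventually_elim
    case (elim B)
    have "(1 - \<delta>) ^ L B = exp (real (L B) * ln (1 - \<delta>))"
      using assms(3) by (simp add: exp_of_nat_mult)
    also have "\<dots> \<le> exp (c * real B powr k * ln (1 - \<delta>))"
      using elim(1) assms(2,3) by (simp add: mult_right_mono_neg)
    also have "\<dots> = exp (- a * real B powr k)"
      by (simp add: a_def mult_ac)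
    finally have "real B ^ 2 * (1 - \<delta>) ^ L B \<le> real B ^ 2 * exp (- a * real B powr k)"
      by (intro mult_left_mono) auto
    with elim(2) show ?case by linarith
  qed
qed

theorem corollary3:
  "\<exists>c::real. \<forall>k1 k2 \<delta> :: real. \<forall>A L :: nat \<Rightarrow> nat.
     asymptotic_regime k1 k2 A L \<longrightarrow> 0 < \<delta> \<longrightarrow> \<delta> < 1 / 2 \<longrightarrow>
     (\<forall>\<^sub>F B in sequentially. fld_ratio (A B) B (L B) \<delta> (L B) \<le> c)"
proof (intro exI[of _ 2] allI impI)
  fix k1 k2 \<delta> :: real and A L :: "nat \<Rightarrow> nat"
  assume regime: "asymptotic_regime k1 k2 A L" and \<delta>: "0 < \<delta>" "\<delta> < 1 / 2"
  have "\<forall>\<^sub>F B in sequentially. 0 < A B" "\<forall>\<^sub>F B in sequentially. 0 < L B"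
    using regime eventually_compose_filterlim[OF eventually_gt_at_top[of 0]]
    by (auto simp: asymptotic_regime_def)
  \<comment> \<open>The lower bound on \<open>L\<close> contained in its \<Theta> growth rate makes
    a collision of blocks unlikely.\<close>
  moreover have "\<forall>\<^sub>F B in sequentially. real B ^ 2 * (1 - \<delta>) ^ L B \<le> 1 / 2"
    using regime \<delta>
    by (intro eventually_power2_mult_power_le[of k1]) (auto simp: asymptotic_regime_def bigtheta_def)
  ultimately show "\<forall>\<^sub>F B in sequentially. fld_ratio (A B) B (L B) \<delta> (L B) \<le> 2"
    using eventually_gt_at_top[of 0]
    by eventually_elim (rule fld_ratio_le_2[OF _ _ _ \<delta>])
qed

end
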